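(* Let $q,r,p,s\in\Bbbk$ with $q\neq 0$ and $p\neq 0$. Let $x_1,x_2,y_1,y_2$ be elements of an associative unital $\Bbbk$-algebra such that \[ x_2x_1=qx_1x_2+rx_1^2,\qquad y_2y_1=py_1y_2+sy_1^2. \] Then, for all integers $m,n\ge 0$, \[ x_2^nx_1^m=\sum_{k=0}^{n}\Lambda_{q,r}(n,m;k)\,x_1^{m+k}x_2^{n-k},\qquad y_2^ny_1^m=\sum_{k=0}^{n}\Lambda_{p,s}(n,m;k)\,y_1^{m+k}y_2^{n-k}. \]
   Context: $\Bbbk$ is an algebraically closed field of characteristic zero. For $q\in\Bbbk^\times$ and integers $n\ge0$: $[n]_q:=1+q+\cdots+q^{n-1}$, $[0]_q:=0$. The Gaussian binomial coefficients $\begin{bmatrix}n\\k\end{bmatrix}_q$ are defined by $\begin{bmatrix}0\\0\end{bmatrix}_q=1$, $\begin{bmatrix}n\\k\end{bmatrix}_q=0$ if $k<0$ or $k>n$, and $\begin{bmatrix}n+1\\k\end{bmatrix}_q=\begin{bmatrix}n\\k-1\end{bmatrix}_q+q^k\begin{bmatrix}n\\k\end{bmatrix}_q$ for $n\ge0$. The $q$-rising factorial is $[m]_q^{\overline{k}}:=\prod_{j=0}^{k-1}[m+j]_q$, with $[m]_q^{\overline{0}}:=1$. For $q\in\Bbbk^\times$, $r\in\Bbbk$ and integers $n,m,k\ge0$, \[ \Lambda_{q,r}(n,m;k):=r^kq^{m(n-k)}\begin{bmatrix}n\\k\end{bmatrix}_q[m]_q^{\overline{k}}, \] with $\Lambda_{q,r}(n,m;k)=0$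 whenever $k>n$, and with the convention $0^0=1$. *)

theory Defs
  imports "HOL-Computational_Algebra.Polynomial"
begin

(* Associative unital algebras over a field. The sort {ring, monoid_mult} is used instead of
   ring_1 because the latter imposes 0 \<noteq> 1 and would exclude the zero algebra. *)
locale unital_algebra = vector_space scale
  for scale :: "'a::field \<Rightarrow> 'b::{ring, monoid_mult} \<Rightarrow> 'b" +
  assumes scale_mult_left: "scale c x * y = scale c (x * y)"
    and scale_mult_right: "x * scale c y = scale c (x * y)"

definition q_number :: "'a::field \<Rightarrow> nat \<Rightarrow> 'a" where
  "q_number q n = (\<Sum>i<n. q ^ i)"

(* The Pascal-type recurrence [n+1, k] = [n, k-1] + q^k [n, k] with lower index in nat.
   In the equation for (Suc n, 0) the term with lower index -1 is 0 and q^0 = 1.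
   The vanishing for k > n follows from the equations, see gauss_binomial_eq_0. *)
fun gauss_binomial :: "'a::field \<Rightarrow> nat \<Rightarrow> nat \<Rightarrow> 'a" where
  "gauss_binomial q 0 0 = 1"
| "gauss_binomial q 0 (Suc k) = 0"
| "gauss_binomial q (Suc n) 0 = gauss_binomial q n 0"
| "gauss_binomial q (Suc n) (Suc k) =
     gauss_binomial q n k + q ^ Suc k * gauss_binomial q n (Suc k)"

lemma gauss_binomial_eq_0: "k > n \<Longrightarrow> gauss_binomial q n k = 0"
  by (induction q n k rule: gauss_binomial.induct) auto

definition q_rising_factorial :: "'a::field \<Rightarrow> nat \<Rightarrow> nat \<Rightarrow> 'a" where
  "q_rising_factorial q m k = (\<Prod>j<k. q_number q (m + j))"

definition Lambda_coeff :: "'a::field \<Rightarrow> 'a \<Rightarrow> nat \<Rightarrow> nat \<Rightarrow> nat \<Rightarrow> 'a" where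
  "Lambda_coeff q r n m k =
     (if k > n then 0
      else r ^ k * q ^ (m * (n - k)) * gauss_binomial q n k * q_rising_factorial q m k)"

end

(* Moving a single x2 past a power of x1 gives
   x2 x1^m = q^m x1^m x2 + r [m]_q x1^(m+1).  Multiplying the expansion of x2^n x1^m by x2 from
   the left therefore turns the coefficients for n into those for n + 1 by the recurrence
   Lambda(n+1, m; k+1) = q^(m+k+1) Lambda(n, m; k+1) + r [m+k]_q Lambda(n, m; k),
   which is the Pascal rule of the Gaussian binomials. *)
theory Submission
  imports Defs
begin

lemma q_number_0: "q_number q 0 = 0"
  by (simp add: q_number_def)

lemma q_number_Suc: "q_number q (Suc n) = q_number q n + q ^ n"
  by (simp add: q_number_def)

lemma Lambda_coeff_eq_0: "k > n \<Longrightarrow> Lambda_coeff q r n m k = 0"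
  by (simp add: Lambda_coeff_def)

lemma Lambda_coeff_0_0: "Lambda_coeff q r 0 m 0 = 1"
  by (simp add: Lambda_coeff_def q_rising_factorial_def)

lemma Lambda_coeff_Suc_0: "Lambda_coeff q r (Suc n) m 0 = q ^ m * Lambda_coeff q r n m 0"
  by (simp add: Lambda_coeff_def power_add algebra_simps)

text \<open>For k < n, the first Pascal summand releases one factor r and the last factor [m+k]_q of
  the rising factorial; in the second, q^(m(n-k)) = q^m q^(m(n-k-1)) supplies the q^m that joins
  q^(k+1).\<close>

lemma Lambda_coeff_Suc_Suc:
  "Lambda_coeff q r (Suc n) m (Suc k) =
     q ^ (m + Suc k) * Lambda_coeff q r n m (Suc k) + r * q_number q (m + k) * Lambda_coeff q r n m k"
proof (cases "k < n")
  case True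
  \<comment> \<open>With this form of \<open>n\<close>, the truncated differences
    \<open>n - k\<close> and \<open>n - Suc k\<close> become \<open>Suc d\<close> and
    \<open>d\<close>.\<close>
  then obtain d where "n = Suc (k + d)"
    using less_imp_Suc_add by blast
  then show ?thesis
    by (simp add: Lambda_coeff_def q_rising_factorial_def power_add algebra_simps)
next
  case False
  \<comment> \<open>For k = n only the term with [m+k]_q survives; for k > n both sides
    vanish.\<close>
  then show ?thesis
    by (simp add: Lambda_coeff_def q_rising_factorial_def gauss_binomial_eq_0 algebra_simps)
qed

context unital_algebra
begin

lemma q_commute_power:
  assumes "x2 * x1 = scale q (x1 * x2) + scale r (x1 ^ 2)"
  shows "x2 * x1 ^ m = scale (q ^ m) (x1 ^ m * x2) + scale (r * q_number q m) (x1 ^ Suc m)"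
proof (induction m)
  case 0
  then show ?case by (simp add: q_number_0)
next
  case (Suc m)
  \<comment> \<open>Splitting off the last x1 leaves a single product x2 x1 to rewrite. The two
    multiples of x1^(m+2) then add up by r [m]_q + q^m r = r [m+1]_q.\<close>
  have "x2 * x1 ^ Suc m = (x2 * x1 ^ m) * x1"
    by (simp only: power_Suc2 mult.assoc)
  also have "\<dots> = scale (q ^ m) (x1 ^ m * (x2 * x1)) + scale (r * q_number q m) (x1 ^ Suc (Suc m))"
    by (simp only: Suc.IH distrib_right scale_mult_left power_Suc2 mult.assoc)
  also have "x1 ^ m * (x2 * x1) = scale q (x1 ^ Suc m * x2) + scale r (x1 ^ Suc (Suc m))"
    by (simp only: assms distrib_left scale_mult_right power_Suc2 power2_eq_square mult.assoc)
  finally show ?case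
    by (simp add: scale_right_distrib q_number_Suc scale_left_distrib distrib_left add_ac mult_ac
        del: power_Suc) (simp add: mult_ac)
qed

theorem power_mult_power_expansion:
  assumes "x2 * x1 = scale q (x1 * x2) + scale r (x1 ^ 2)"
  shows "x2 ^ n * x1 ^ m =
    (\<Sum>k=0..n. scale (Lambda_coeff q r n m k) (x1 ^ (m + k) * x2 ^ (n - k)))"
proof (induction n)
  case 0
  then show ?case by (simp add: Lambda_coeff_0_0)
next
  case (Suc n)
  define L where "L = Lambda_coeff q r n m"
  \<comment> \<open>These are the monomials of the expansion for n + 1; multiplying the k-th
    monomial for n by x2 from the left gives only \<open>T k\<close> and
    \<open>T (Suc k)\<close>.\<close>
  define T where "T k = x1 ^ (m + k) * x2 ^ (Suc n - k)" for k
  have step: "x2 * (x1 ^ (m + k) * x2 ^ (n - k)) =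
      scale (q ^ (m + k)) (T k) + scale (r * q_number q (m + k)) (T (Suc k))" if "k \<le> n" for k
    by (simp add: mult.assoc[symmetric] q_commute_power[OF assms] distrib_right scale_mult_left
        T_def Suc_diff_le[OF that] del: power_Suc)
      (simp add: mult.assoc)
  have "x2 ^ Suc n * x1 ^ m = (\<Sum>k=0..n. scale (L k) (x2 * (x1 ^ (m + k) * x2 ^ (n - k))))"
    by (simp add: Suc.IH mult.assoc sum_distrib_left scale_mult_right L_def)
  also have "\<dots> = (\<Sum>k=0..n. scale (q ^ (m + k) * L k) (T k)) +
      (\<Sum>k=0..n. scale (r * q_number q (m + k) * L k) (T (Suc k)))"
    unfolding sum.distrib[symmetric]
    by (intro sum.cong) (simp_all add: step scale_right_distrib mult_ac)
  \<comment> \<open>The added term is zero because \<open>L (Suc n) = 0\<close>. After splitting off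
    k = 0, the shifted sum has the same range and the same monomials \<open>T (Suc k)\<close> as the
    second sum, so coefficients can be compared.\<close>
  also have "(\<Sum>k=0..n. scale (q ^ (m + k) * L k) (T k)) =
      (\<Sum>k=0..Suc n. scale (q ^ (m + k) * L k) (T k))"
    by (simp add: L_def Lambda_coeff_eq_0)
  also have "\<dots> = scale (q ^ m * L 0) (T 0) +
      (\<Sum>k=0..n. scale (q ^ (m + Suc k) * L (Suc k)) (T (Suc k)))"
    by (simp only: sum.atLeast0_atMost_Suc_shift o_def add_0_right)
  also have "\<dots> + (\<Sum>k=0..n. scale (r * q_number q (m + k) * L k) (T (Suc k))) =
      scale (Lambda_coeff q r (Suc n) m 0) (T 0) +
      (\<Sum>k=0..n. scale (Lambda_coeff q r (Suc n) m (Suc k)) (T (Suc k)))"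
    by (simp only: L_def Lambda_coeff_Suc_0 Lambda_coeff_Suc_Suc scale_left_distrib sum.distrib
        add.assoc)
  also have "\<dots> = (\<Sum>k=0..Suc n. scale (Lambda_coeff q r (Suc n) m k) (T k))"
    by (simp only: sum.atLeast0_atMost_Suc_shift o_def)
  finally show ?case
    by (simp only: T_def)
qed

end

theorem proposition3p1:
  fixes scale :: "'a::{alg_closed_field, field_char_0} \<Rightarrow> 'b::{ring, monoid_mult} \<Rightarrow> 'b"
    and q r p s :: 'a
    and x1 x2 y1 y2 :: 'b
  assumes "unital_algebra scale"
    and "q \<noteq> 0" and "p \<noteq> 0"
    and "x2 * x1 = scale q (x1 * x2) + scale r (x1 ^ 2)"
    and "y2 * y1 = scale p (y1 * y2) + scale s (y1 ^ 2)"
  shows "\<forall>m n :: nat.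
      x2 ^ n * x1 ^ m = (\<Sum>k=0..n. scale (Lambda_coeff q r n m k) (x1 ^ (m + k) * x2 ^ (n - k))) \<and>
      y2 ^ n * y1 ^ m = (\<Sum>k=0..n. scale (Lambda_coeff p s n m k) (y1 ^ (m + k) * y2 ^ (n - k)))"
  using unital_algebra.power_mult_power_expansion[OF assms(1) assms(4)]
    unital_algebra.power_mult_power_expansion[OF assms(1) assms(5)]
  by blast

end
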